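(* In the linear system with Kalman recursion described in the context, the a posteriori update $$\widehat{\mathbf{x}}_{t|t}=\widehat{\mathbf{x}}_{t|t-1}+K_t(\mathbf{z}_t-H_t\widehat{\mathbf{x}}_{t|t-1}),\qquad K_t=\Sigma_{t|t-1}H_t^{T}(H_t\Sigma_{t|t-1}H_t^{T}+R_t)^{-1},$$ is, at each step $t\ge 1$, an optimal unbiased linear estimator for fusing the a priori state estimate with the measurement. That is, for every $t\ge1$: (i) $E[\widehat{\mathbf{x}}_{t|t}]=E[\mathbf{x}_t]$; (ii) among all unbiased linear fusion rules $\widehat{\mathbf{y}}=A\,\widehat{\mathbf{x}}_{t|t-1}+L\,\mathbf{z}_t$, i.e. those with $A=I-LH_t$ (where the gain $K_s$ has been used at all steps $s<t$), the mean square error $MSE_t(L)$ defined in the context is minimized at $L=K_t$.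
   Context: State evolution and measurement: for $t=1,2,\dots$, $$\mathbf{x}_t=F_t\mathbf{x}_{t-1}+B_t\mathbf{u}_t+\mathbf{w}_t,\qquad \mathbf{z}_t=H_t\mathbf{x}_t+\mathbf{v}_t,$$ where $\mathbf{x}_0$ is a random vector in $\mathbb{R}^d$, $F_t,B_t,H_t$ are deterministic real matrices ($H_t$ of full row rank), $\mathbf{u}_t$ is a deterministic control input, $\mathbf{w}_t$ is zero-mean noise with covariance matrix $Q_t$, and $\mathbf{v}_t$ is zero-mean noise with covariance matrix $R_t$. The $\mathbf{w}_t$ are uncorrelated with each other and with $\mathbf{x}_0$; the $\mathbf{v}_t$ are uncorrelated with each other, with the initial estimate, and with all $\mathbf{w}_k$. Kalman recursion: the initial estimate $\widehat{\mathbf{x}}_{0|0}$ satisfies $E[\widehat{\mathbf{x}}_{0|0}]=E[\mathbf{x}_0]$ and has an associated covariance matrix $\Sigma_{0|0}$ (symmetric positive semidefinite). For $t\ge1$, prediction gives the a priori estimate and its covariance $$\widehat{\mathbf{x}}_{t|t-1}=F_t\widehat{\mathbf{x}}_{t-1|t-1}+B_t\mathbf{u}_t,\qquad \Sigma_{t|t-1}=F_t\Sigma_{t-1|t-1}F_t^{T}+Q_t,$$ and fusion gives the a posteriori estimate $\widehat{\mathbf{x}}_{t|t}=\widehat{\mathbf{x}}_{t|t-1}+K_t(\mathbf{z}_t-H_t\widehat{\mathbf{x}}_{t|t-1})$ with $K_t=\Sigma_{t|t-1}H_t^{T}(H_t\Sigma_{t|t-1}H_t^{T}+R_t)^{-1}$,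 and covariance $\Sigma_{t|t}=(I-K_tH_t)\Sigma_{t|t-1}$. The matrices $H_t\Sigma_{t|t-1}H_t^{T}+R_t$ are assumed invertible. Mean square error: for fusion at time $t$ the a priori estimate is treated as a random vector with covariance matrix $\Sigma_{t|t-1}$, and the measurement as a random vector with covariance matrix $R_t$ (its variability comes only from $\mathbf{v}_t$, the actual state being regarded as a fixed realization), the two being uncorrelated. The mean square error of an unbiased rule with gain $L$ is the trace of the covariance matrix of the fused estimate, i.e. $$MSE_t(L)=\operatorname{trace}\big((I-LH_t)\Sigma_{t|t-1}(I-LH_t)^{T}+LR_tL^{T}\big).$$ *)

theory Defs
  imports "HOL-Probability.Probability"
begin

text \<open>
  Random vectors are functions \<^term>\<open>X :: 'a \<Rightarrow> real ^ 'n\<close> on a probability space; their mean is the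
  Bochner integral \<^term>\<open>integral\<^sup>L M X\<close>.
\<close>

definition cross_covariance ::
  "'a measure \<Rightarrow> ('a \<Rightarrow> real ^ 'n) \<Rightarrow> ('a \<Rightarrow> real ^ 'm) \<Rightarrow> real ^ 'm ^ 'n" where
  "cross_covariance M X Y =
     (\<chi> i j. \<integral>\<omega>. (X \<omega> $ i - integral\<^sup>L M X $ i) * (Y \<omega> $ j - integral\<^sup>L M Y $ j) \<partial>M)"

text \<open>The Bochner integral of a non-integrable function is a dummy value, so the existence of
  the moments is part of the next two definitions.\<close>

definition has_covariance_matrix ::
  "'a measure \<Rightarrow> ('a \<Rightarrow> real ^ 'n) \<Rightarrow> real ^ 'n ^ 'n \<Rightarrow> bool" where
  "has_covariance_matrix M X S \<longleftrightarrow>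
     integrable M X \<and> (\<forall>i. integrable M (\<lambda>\<omega>. (X \<omega> $ i)\<^sup>2)) \<and> cross_covariance M X X = S"

definition uncorrelated ::
  "'a measure \<Rightarrow> ('a \<Rightarrow> real ^ 'n) \<Rightarrow> ('a \<Rightarrow> real ^ 'm) \<Rightarrow> bool" where
  "uncorrelated M X Y \<longleftrightarrow>
     integrable M X \<and> integrable M Y \<and>
     (\<forall>i j. integrable M (\<lambda>\<omega>. X \<omega> $ i * Y \<omega> $ j)) \<and> cross_covariance M X Y = 0"

definition sym_pos_semidef :: "real ^ 'n ^ 'n \<Rightarrow> bool" where
  "sym_pos_semidef S \<longleftrightarrow> transpose S = S \<and> (\<forall>x. 0 \<le> x \<bullet> (S *v x))"

text \<open>
  Mean square error of the unbiased fusion rule \<^term>\<open>(mat 1 - L ** H) *v X + L *v Z\<close>, for an a priori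
  estimate \<^term>\<open>X\<close> with covariance matrix \<^term>\<open>S\<close> and an uncorrelated measurement \<^term>\<open>Z\<close> with
  covariance matrix \<^term>\<open>R\<close>. That this is the trace of the covariance matrix of the fused
  estimate is \<open>trace_covariance_fused\<close> below.
\<close>

definition fusion_mse ::
  "real ^ 'd ^ 'd \<Rightarrow> real ^ 'd ^ 'm \<Rightarrow> real ^ 'm ^ 'm \<Rightarrow> real ^ 'm ^ 'd \<Rightarrow> real" where
  "fusion_mse S H R L =
     trace ((mat 1 - L ** H) ** S ** transpose (mat 1 - L ** H) + L ** R ** transpose L)"

text \<open>A linear rule reproduces every fixed state exactly when it has the form considered above.\<close>

lemma unbiased_rule_iff:
  fixes A :: "real ^ 'd ^ 'd" and L :: "real ^ 'm ^ 'd" and H :: "real ^ 'd ^ 'm"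
  shows "(\<forall>x. A *v x + L *v (H *v x) = x) \<longleftrightarrow> A = mat 1 - L ** H"
proof -
  have "(\<forall>x. A *v x + L *v (H *v x) = x) \<longleftrightarrow> (\<forall>x. (A + L ** H) *v x = mat 1 *v x)"
    by (simp add: matrix_vector_mul_assoc matrix_vector_mult_add_rdistrib)
  also have "\<dots> \<longleftrightarrow> A + L ** H = mat 1"
    by (simp add: matrix_eq)
  also have "\<dots> \<longleftrightarrow> A = mat 1 - L ** H"
    by (simp add: eq_diff_eq)
  finally show ?thesis .
qed

lemma integrable_component:
  fixes X :: "'a \<Rightarrow> real ^ 'n"
  assumes "integrable M X"
  shows "integrable M (\<lambda>\<omega>. X \<omega> $ i)" "(\<integral>\<omega>. X \<omega> $ i \<partial>M) = integral\<^sup>L M X $ i"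
  using integrable_bounded_linear[OF bounded_linear_vec_nth assms]
    integral_bounded_linear[OF bounded_linear_vec_nth assms] by auto

lemma has_covariance_matrix_prod:
  assumes "has_covariance_matrix M X S"
  shows "integrable M (\<lambda>\<omega>. X \<omega> $ i * X \<omega> $ j)"
proof (rule Bochner_Integration.integrable_bound)
  show "integrable M (\<lambda>\<omega>. (X \<omega> $ i)\<^sup>2 + (X \<omega> $ j)\<^sup>2)"
    using assms by (simp add: has_covariance_matrix_def)
  have "\<And>k. (\<lambda>\<omega>. X \<omega> $ k) \<in> borel_measurable M"
    using assms integrable_component(1) borel_measurable_integrable
    unfolding has_covariance_matrix_def by blast
  then show "(\<lambda>\<omega>. X \<omega> $ i * X \<omega> $ j) \<in> borel_measurable M" by simp
  have "\<bar>a * b\<bar> \<le> a\<^sup>2 + b\<^sup>2" for a b :: real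
  proof -
    have "2 * (\<bar>a\<bar> * \<bar>b\<bar>) \<le> a\<^sup>2 + b\<^sup>2"
      using sum_squares_bound[of "\<bar>a\<bar>" "\<bar>b\<bar>"] by simp
    moreover have "0 \<le> \<bar>a\<bar> * \<bar>b\<bar>" by simp
    ultimately show ?thesis unfolding abs_mult by linarith
  qed
  then show "AE \<omega> in M. norm (X \<omega> $ i * X \<omega> $ j) \<le> norm ((X \<omega> $ i)\<^sup>2 + (X \<omega> $ j)\<^sup>2)"
    by (auto intro!: always_eventually simp: abs_of_nonneg)
qed

lemma trace_covariance_fused:
  fixes X :: "'a \<Rightarrow> real ^ 'd" and Z :: "'a \<Rightarrow> real ^ 'm"
    and H :: "real ^ 'd ^ 'm" and L :: "real ^ 'm ^ 'd"
  assumes "prob_space M"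
    and X: "has_covariance_matrix M X S" and Z: "has_covariance_matrix M Z R"
    and XZ: "uncorrelated M X Z"
  defines "Y \<equiv> \<lambda>\<omega>. (mat 1 - L ** H) *v X \<omega> + L *v Z \<omega>"
  shows "trace (cross_covariance M Y Y) = fusion_mse S H R L"
proof -
  interpret prob_space M by fact
  define A where "A = mat 1 - L ** H"
  define X' where "X' = (\<lambda>\<omega>. X \<omega> - integral\<^sup>L M X)"
  define Z' where "Z' = (\<lambda>\<omega>. Z \<omega> - integral\<^sup>L M Z)"
  have iX: "integrable M X" and iZ: "integrable M Z"
    using X Z by (auto simp: has_covariance_matrix_def)
  have blA: "bounded_linear ((*v) A)" and blL: "bounded_linear ((*v) L)"
    by (simp_all add: linear_linear)
  have EY: "integral\<^sup>L M Y = A *v integral\<^sup>L M X + L *v integral\<^sup>L M Z"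
    unfolding Y_def A_def[symmetric]
    using integral_bounded_linear[OF blA iX] integral_bounded_linear[OF blL iZ]
      integrable_bounded_linear[OF blA iX] integrable_bounded_linear[OF blL iZ] by simp
  have Y': "Y \<omega> $ i - integral\<^sup>L M Y $ i = (A *v X' \<omega>) $ i + (L *v Z' \<omega>) $ i" for \<omega> i
    unfolding EY by (simp add: Y_def A_def[symmetric] X'_def Z'_def matrix_vector_mult_diff_distrib)
  note c = integrable_component(1)[OF iX] integrable_component(1)[OF iZ]
  have pXX: "integrable M (\<lambda>\<omega>. X' \<omega> $ j * X' \<omega> $ k)" for j k
    using has_covariance_matrix_prod[OF X] c by (simp add: X'_def algebra_simps)
  have pZZ: "integrable M (\<lambda>\<omega>. Z' \<omega> $ j * Z' \<omega> $ k)" for j k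
    using has_covariance_matrix_prod[OF Z] c by (simp add: Z'_def algebra_simps)
  have pXZ: "integrable M (\<lambda>\<omega>. X' \<omega> $ j * Z' \<omega> $ k)" for j k
    using XZ c by (simp add: uncorrelated_def X'_def Z'_def algebra_simps)
  have eXX: "(\<integral>\<omega>. X' \<omega> $ j * X' \<omega> $ k \<partial>M) = S $ j $ k" for j k
    using X by (auto simp: has_covariance_matrix_def cross_covariance_def X'_def)
  have eZZ: "(\<integral>\<omega>. Z' \<omega> $ j * Z' \<omega> $ k \<partial>M) = R $ j $ k" for j k
    using Z by (auto simp: has_covariance_matrix_def cross_covariance_def Z'_def)
  have eXZ: "(\<integral>\<omega>. X' \<omega> $ j * Z' \<omega> $ k \<partial>M) = 0" for j k
    using XZ by (auto simp: uncorrelated_def cross_covariance_def X'_def Z'_def vec_eq_iff)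
  have "cross_covariance M Y Y $ i $ i = (A ** S ** transpose A + L ** R ** transpose L) $ i $ i" for i
  proof -
    have "cross_covariance M Y Y $ i $ i =
      (\<integral>\<omega>. (\<Sum>k\<in>UNIV. \<Sum>j\<in>UNIV. A $ i $ j * A $ i $ k * (X' \<omega> $ j * X' \<omega> $ k))
         + 2 * (\<Sum>k\<in>UNIV. \<Sum>j\<in>UNIV. A $ i $ j * L $ i $ k * (X' \<omega> $ j * Z' \<omega> $ k))
         + (\<Sum>k\<in>UNIV. \<Sum>j\<in>UNIV. L $ i $ j * L $ i $ k * (Z' \<omega> $ j * Z' \<omega> $ k)) \<partial>M)"
    proof -
      have e: "(\<Sum>k\<in>UNIV. \<Sum>j\<in>UNIV. a j * b k * (x j * y k)) = (\<Sum>j\<in>UNIV. a j * x j) * (\<Sum>k\<in>UNIV. b k * y k)"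
        for a x :: "'p::finite \<Rightarrow> real" and b y :: "'q::finite \<Rightarrow> real"
        unfolding sum_product by (subst sum.swap) (simp add: mult_ac)
      show ?thesis unfolding cross_covariance_def Y'
        by (simp add: e) (simp add: matrix_vector_mult_def algebra_simps)
    qed
    also have "\<dots> = (\<Sum>k\<in>UNIV. \<Sum>j\<in>UNIV. A $ i $ j * A $ i $ k * S $ j $ k)
         + (\<Sum>k\<in>UNIV. \<Sum>j\<in>UNIV. L $ i $ j * L $ i $ k * R $ j $ k)"
      by (simp add: pXX pXZ pZZ eXX eXZ eZZ)
    also have "\<dots> = (A ** S ** transpose A + L ** R ** transpose L) $ i $ i"
      by (simp add: matrix_matrix_mult_def transpose_def sum_distrib_left sum_distrib_right mult_ac)
    finally show ?thesis .
  qed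
  then show ?thesis
    unfolding fusion_mse_def A_def[symmetric] trace_def by simp
qed

end

theory Submission imports Defs begin

text \<open>
  Write \<open>J L\<close> for the matrix whose trace is \<^term>\<open>fusion_mse S H R L\<close> and \<open>C = H S H\<^sup>T + R\<close>. The gain is
  chosen so that \<open>K C = S H\<^sup>T\<close>, and completing the square gives
  \<open>J L = (I - K H) S + (L - K) C (L - K)\<^sup>T\<close>. Once \<open>S\<close> and \<open>R\<close>, hence \<open>C\<close>, are symmetric positive
  semidefinite, the second summand has nonnegative trace, so \<open>L = K\<close> is optimal. The case \<open>L = K\<close> of
  the same identity shows that the updated covariance matrix \<open>(I - K H) S\<close> equals \<open>J K\<close> and so is again
  symmetric positive semidefinite, which carries this property along the recursion.
\<close>

lemma matrix_diff_ldistrib: "A ** (B - C) = A ** B - A ** C"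
  for A :: "'a::ring_1 ^ 'n ^ 'm" and B C :: "'a ^ 'p ^ 'n"
  by (simp add: vec_eq_iff matrix_matrix_mult_def right_diff_distrib sum_subtractf)

lemma matrix_diff_rdistrib: "(A - B) ** C = A ** C - B ** C"
  for A B :: "'a::ring_1 ^ 'n ^ 'm" and C :: "'a ^ 'p ^ 'n"
  by (simp add: vec_eq_iff matrix_matrix_mult_def left_diff_distrib sum_subtractf)

lemma matrix_add_rdistrib: "(A + B) ** C = A ** C + B ** C"
  for A B :: "'a::semiring_1 ^ 'n ^ 'm" and C :: "'a ^ 'p ^ 'n"
  by (simp add: vec_eq_iff matrix_matrix_mult_def distrib_right sum.distrib)

lemma transpose_add: "transpose (A + B) = transpose A + transpose B"
  by (simp add: vec_eq_iff transpose_def)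

lemma transpose_diff: "transpose (A - B) = transpose A - transpose B"
  by (simp add: vec_eq_iff transpose_def)

lemma matrix_inv_left_inverse:
  assumes "invertible A"
  shows "matrix_inv A ** A = mat 1"
  using someI_ex[OF assms[unfolded invertible_def]] by (simp add: matrix_inv_def)

lemma sym_pos_semidef_add:
  assumes "sym_pos_semidef S" "sym_pos_semidef T"
  shows "sym_pos_semidef (S + T)"
  using assms
  by (simp add: sym_pos_semidef_def transpose_add matrix_vector_mult_add_rdistrib inner_add_right)

text \<open>The quadratic form of the product at \<open>x\<close> is that of \<open>S\<close> at
  \<open>transpose A *v x\<close>. Since \<open>A\<close> may be rectangular, this applies to the
  transition, measurement and gain matrices alike.\<close>

lemma sym_pos_semidef_congruence:
  fixes A :: "real ^ 'n ^ 'm"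
  assumes "sym_pos_semidef S"
  shows "sym_pos_semidef (A ** S ** transpose A)"
proof -
  have "x \<bullet> ((A ** S ** transpose A) *v x) = (transpose A *v x) \<bullet> (S *v (transpose A *v x))" for x
    by (simp add: dot_lmul_matrix matrix_vector_mul_assoc[symmetric])
  then show ?thesis
    using assms by (simp add: sym_pos_semidef_def matrix_transpose_mul matrix_mul_assoc)
qed

text \<open>Each diagonal entry is the quadratic form at a standard basis vector.\<close>

lemma sym_pos_semidef_trace_nonneg:
  assumes "sym_pos_semidef S"
  shows "0 \<le> trace S"
proof -
  have "S $ i $ i = axis i 1 \<bullet> (S *v axis i 1)" for i
    by (simp add: matrix_vector_mult_basis column_def inner_axis')
  then show ?thesis
    using assms by (simp add: trace_def sym_pos_semidef_def sum_nonneg)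
qed

text \<open>The quadratic form at \<open>x\<close> is the variance of the scalar
  \<open>x \<bullet> X\<close>. This supplies semidefiniteness of \<open>Q t\<close> and
  \<open>R t\<close>, which are given only as covariance matrices of the noise.\<close>

lemma has_covariance_matrix_sym_pos_semidef:
  fixes X :: "'a \<Rightarrow> real ^ 'n"
  assumes "prob_space M" and X: "has_covariance_matrix M X S"
  shows "sym_pos_semidef S"
proof -
  interpret prob_space M by fact
  define X' where "X' = (\<lambda>\<omega>. X \<omega> - integral\<^sup>L M X)"
  have "integrable M X"
    using X by (simp add: has_covariance_matrix_def)
  note c = integrable_component(1)[OF this]
  \<comment> \<open>Needed to pull the integral through the double sum that expands the square
    below.\<close>
  have i: "integrable M (\<lambda>\<omega>. X' \<omega> $ j * X' \<omega> $ k)" for j k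
    using has_covariance_matrix_prod[OF X] c by (simp add: X'_def algebra_simps)
  have S: "S $ j $ k = (\<integral>\<omega>. X' \<omega> $ j * X' \<omega> $ k \<partial>M)" for j k
    using X by (auto simp: has_covariance_matrix_def cross_covariance_def X'_def)
  have "x \<bullet> (S *v x) = (\<integral>\<omega>. (x \<bullet> X' \<omega>)\<^sup>2 \<partial>M)" for x
  proof -
    have "(x \<bullet> X' \<omega>)\<^sup>2 = (\<Sum>j\<in>UNIV. \<Sum>k\<in>UNIV. x $ j * x $ k * (X' \<omega> $ j * X' \<omega> $ k))" for \<omega>
      by (simp add: inner_vec_def power2_eq_square sum_product mult_ac)
    then show ?thesis
      by (simp add: i S[symmetric])
        (simp add: inner_vec_def matrix_vector_mult_def sum_distrib_left mult_ac)
  qed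
  moreover have "transpose S = S"
    by (simp add: vec_eq_iff transpose_def S mult.commute)
  ultimately show ?thesis
    by (simp add: sym_pos_semidef_def)
qed

text \<open>The gain enters only through \<open>K ** C = S ** transpose H\<close>, so no inverse has
  to be handled. By symmetry of \<open>S\<close> and \<open>R\<close>, transposing gives
  \<open>C ** transpose K = H ** S\<close>; the two equations evaluate all terms of the expanded
  square that contain \<open>K\<close>.\<close>

lemma fusion_covariance_complete_square:
  fixes S :: "real ^ 'd ^ 'd" and H :: "real ^ 'd ^ 'm" and R :: "real ^ 'm ^ 'm"
    and K L :: "real ^ 'm ^ 'd"
  defines "C \<equiv> H ** S ** transpose H + R"
  assumes S: "transpose S = S" and R: "transpose R = R"
    and K: "K ** C = S ** transpose H"
  shows "(mat 1 - L ** H) ** S ** transpose (mat 1 - L ** H) + L ** R ** transpose L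
    = (mat 1 - K ** H) ** S + (L - K) ** C ** transpose (L - K)"
proof -
  have "transpose C = C"
    by (simp add: C_def S R transpose_add matrix_transpose_mul matrix_mul_assoc)
  then have K': "C ** transpose K = H ** S"
    using arg_cong[OF K, of transpose] by (simp add: matrix_transpose_mul S)
  \<comment> \<open>The bracketing exposes \<open>C ** transpose K\<close> for the rewriting that
    follows.\<close>
  have "(L - K) ** C ** transpose (L - K) =
      L ** C ** transpose L - L ** (C ** transpose K) - K ** C ** transpose L + K ** (C ** transpose K)"
    by (simp add: matrix_diff_ldistrib matrix_diff_rdistrib transpose_diff matrix_mul_assoc)
  also have "\<dots> = L ** C ** transpose L - L ** H ** S - S ** transpose H ** transpose L + K ** H ** S"
    unfolding K K' by (simp add: matrix_mul_assoc)
  finally have "(L - K) ** C ** transpose (L - K) =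
      L ** C ** transpose L - L ** H ** S - S ** transpose H ** transpose L + K ** H ** S" .
  then show ?thesis
    \<comment> \<open>The square is replaced while still folded, and only then is \<open>C\<close>
      unfolded; the two occurrences of \<open>K ** H ** S\<close> cancel.\<close>
    by (simp only:) (simp add: C_def matrix_diff_ldistrib matrix_diff_rdistrib transpose_diff matrix_transpose_mul
        matrix_add_ldistrib matrix_add_rdistrib matrix_mul_assoc)
qed

lemma integral_matrix_vector_mult:
  fixes A :: "real ^ 'n ^ 'm"
  assumes "integrable M X"
  shows "integrable M (\<lambda>\<omega>. A *v X \<omega>)" "(\<integral>\<omega>. A *v X \<omega> \<partial>M) = A *v integral\<^sup>L M X"
proof -
  have "bounded_linear ((*v) A)"
    by (simp add: linear_linear)
  then show "integrable M (\<lambda>\<omega>. A *v X \<omega>)" "(\<integral>\<omega>. A *v X \<omega> \<partial>M) = A *v integral\<^sup>L M X"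
    using assms by (rule integrable_bounded_linear, rule integral_bounded_linear)
qed

theorem mainTheorem6:
  fixes M :: "'a measure"
    and F :: "nat \<Rightarrow> real ^ 'd ^ 'd" and B :: "nat \<Rightarrow> real ^ 'k ^ 'd" and H :: "nat \<Rightarrow> real ^ 'd ^ 'm"
    and Q :: "nat \<Rightarrow> real ^ 'd ^ 'd" and R :: "nat \<Rightarrow> real ^ 'm ^ 'm"
    and u :: "nat \<Rightarrow> real ^ 'k"
    and x w :: "nat \<Rightarrow> 'a \<Rightarrow> real ^ 'd" and z v :: "nat \<Rightarrow> 'a \<Rightarrow> real ^ 'm"
    and x_prior x_post :: "nat \<Rightarrow> 'a \<Rightarrow> real ^ 'd"
    and S_prior S_post :: "nat \<Rightarrow> real ^ 'd ^ 'd"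
    and K :: "nat \<Rightarrow> real ^ 'm ^ 'd"
  assumes prob: "prob_space M"
    and state: "\<And>t \<omega>. 1 \<le> t \<Longrightarrow> \<omega> \<in> space M \<Longrightarrow>
          x t \<omega> = F t *v x (t - 1) \<omega> + B t *v u t + w t \<omega>"
    and measurement: "\<And>t \<omega>. 1 \<le> t \<Longrightarrow> \<omega> \<in> space M \<Longrightarrow> z t \<omega> = H t *v x t \<omega> + v t \<omega>"
    and full_row_rank: "\<And>t. 1 \<le> t \<Longrightarrow> rank (H t) = CARD('m)"
    and x0: "integrable M (x 0)"
    and w_mean: "\<And>t. 1 \<le> t \<Longrightarrow> integral\<^sup>L M (w t) = 0"
    and w_cov: "\<And>t. 1 \<le> t \<Longrightarrow> has_covariance_matrix M (w t) (Q t)"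
    and v_mean: "\<And>t. 1 \<le> t \<Longrightarrow> integral\<^sup>L M (v t) = 0"
    and v_cov: "\<And>t. 1 \<le> t \<Longrightarrow> has_covariance_matrix M (v t) (R t)"
    and w_w: "\<And>s t. 1 \<le> s \<Longrightarrow> 1 \<le> t \<Longrightarrow> s \<noteq> t \<Longrightarrow> uncorrelated M (w s) (w t)"
    and w_x0: "\<And>t. 1 \<le> t \<Longrightarrow> uncorrelated M (w t) (x 0)"
    and v_v: "\<And>s t. 1 \<le> s \<Longrightarrow> 1 \<le> t \<Longrightarrow> s \<noteq> t \<Longrightarrow> uncorrelated M (v s) (v t)"
    and v_est0: "\<And>t. 1 \<le> t \<Longrightarrow> uncorrelated M (v t) (x_post 0)"
    and v_w: "\<And>s t. 1 \<le> s \<Longrightarrow> 1 \<le> t \<Longrightarrow> uncorrelated M (v s) (w t)"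
    and est0: "integrable M (x_post 0)"
    and est0_mean: "integral\<^sup>L M (x_post 0) = integral\<^sup>L M (x 0)"
    and cov0: "sym_pos_semidef (S_post 0)"
    and predict: "\<And>t \<omega>. 1 \<le> t \<Longrightarrow> \<omega> \<in> space M \<Longrightarrow>
          x_prior t \<omega> = F t *v x_post (t - 1) \<omega> + B t *v u t"
    and predict_cov: "\<And>t. 1 \<le> t \<Longrightarrow>
          S_prior t = F t ** S_post (t - 1) ** transpose (F t) + Q t"
    and innovation_invertible: "\<And>t. 1 \<le> t \<Longrightarrow>
          invertible (H t ** S_prior t ** transpose (H t) + R t)"
    and gain: "\<And>t. 1 \<le> t \<Longrightarrow>
          K t = S_prior t ** transpose (H t) ** matrix_inv (H t ** S_prior t ** transpose (H t) + R t)"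
    and fuse: "\<And>t \<omega>. 1 \<le> t \<Longrightarrow> \<omega> \<in> space M \<Longrightarrow>
          x_post t \<omega> = x_prior t \<omega> + K t *v (z t \<omega> - H t *v x_prior t \<omega>)"
    and fuse_cov: "\<And>t. 1 \<le> t \<Longrightarrow> S_post t = (mat 1 - K t ** H t) ** S_prior t"
  shows "\<forall>t\<ge>1.
      (integrable M (x t) \<and> integrable M (x_post t) \<and>
       integral\<^sup>L M (x_post t) = integral\<^sup>L M (x t)) \<and>
      (\<forall>L. fusion_mse (S_prior t) (H t) (R t) (K t) \<le> fusion_mse (S_prior t) (H t) (R t) L)"
proof -
  interpret prob_space M by (rule prob)
  \<comment> \<open>Integrability is part of the induction claim because linearity of the Bochner
    integral requires it.\<close>
  have mean: "integrable M (x t) \<and> integrable M (x_post t) \<and>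
      integral\<^sup>L M (x_post t) = integral\<^sup>L M (x t)" for t
  proof (induction t)
    case 0
    show ?case using x0 est0 est0_mean by simp
  next
    case (Suc t)
    \<comment> \<open>The system equations hold only on \<open>space M\<close>, so the new state,
      prediction and fused estimate are first studied as total functions \<open>y\<close>,
      \<open>p\<close>, \<open>q\<close> and transferred back by congruence.\<close>
    define y where "y = (\<lambda>\<omega>. F (Suc t) *v x t \<omega> + B (Suc t) *v u (Suc t) + w (Suc t) \<omega>)"
    define p where "p = (\<lambda>\<omega>. F (Suc t) *v x_post t \<omega> + B (Suc t) *v u (Suc t))"
    define q where
      "q = (\<lambda>\<omega>. p \<omega> + K (Suc t) *v (H (Suc t) *v y \<omega> + v (Suc t) \<omega> - H (Suc t) *v p \<omega>))"
    have ix: "integrable M (x t)" and ip: "integrable M (x_post t)"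
      and e: "integral\<^sup>L M (x_post t) = integral\<^sup>L M (x t)"
      using Suc by auto
    have iw: "integrable M (w (Suc t))" and iv: "integrable M (v (Suc t))"
      using w_cov[of "Suc t"] v_cov[of "Suc t"] by (simp_all add: has_covariance_matrix_def)
    have y: "integrable M y" "integral\<^sup>L M y = F (Suc t) *v integral\<^sup>L M (x t) + B (Suc t) *v u (Suc t)"
      using w_mean[of "Suc t"] iw integral_matrix_vector_mult[OF ix, of "F (Suc t)"]
      by (simp_all add: y_def prob_space)
    have p: "integrable M p" "integral\<^sup>L M p = integral\<^sup>L M y"
      using integral_matrix_vector_mult[OF ip, of "F (Suc t)"]
      by (simp_all add: p_def y(2) e prob_space)
    \<comment> \<open>As \<open>p\<close> and \<open>y\<close> have equal means, the innovation has
      mean zero, so no choice of gain could introduce a bias.\<close>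
    have "integrable M (\<lambda>\<omega>. H (Suc t) *v y \<omega> + v (Suc t) \<omega> - H (Suc t) *v p \<omega>)"
      "(\<integral>\<omega>. H (Suc t) *v y \<omega> + v (Suc t) \<omega> - H (Suc t) *v p \<omega> \<partial>M) = 0"
      using v_mean[of "Suc t"] iv integral_matrix_vector_mult[OF y(1), of "H (Suc t)"]
        integral_matrix_vector_mult[OF p(1), of "H (Suc t)"]
      by (simp_all add: p(2))
    note innovation = integral_matrix_vector_mult[OF this(1), of "K (Suc t)", unfolded this(2)]
    have q: "integrable M q" "integral\<^sup>L M q = integral\<^sup>L M y"
      using innovation p by (simp_all add: q_def)
    have xy: "x (Suc t) \<omega> = y \<omega>" "x_post (Suc t) \<omega> = q \<omega>" if "\<omega> \<in> space M" for \<omega>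
      using state[of "Suc t" \<omega>] measurement[of "Suc t" \<omega>] predict[of "Suc t" \<omega>]
        fuse[of "Suc t" \<omega>] that
      by (simp_all add: y_def p_def q_def)
    have "integrable M (x (Suc t)) = integrable M y" "integrable M (x_post (Suc t)) = integrable M q"
      "integral\<^sup>L M (x (Suc t)) = integral\<^sup>L M y" "integral\<^sup>L M (x_post (Suc t)) = integral\<^sup>L M q"
      using xy by (auto intro!: Bochner_Integration.integrable_cong Bochner_Integration.integral_cong)
    then show ?case
      using y(1) q by simp
  qed
  have Q: "sym_pos_semidef (Q t)" and R: "sym_pos_semidef (R t)" if "1 \<le> t" for t
    using that w_cov v_cov has_covariance_matrix_sym_pos_semidef[OF prob] by blast+
  have K: "K t ** (H t ** S_prior t ** transpose (H t) + R t) = S_prior t ** transpose (H t)"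
    if "1 \<le> t" for t
    using gain[OF that] matrix_inv_left_inverse[OF innovation_invertible[OF that]]
    by (simp add: matrix_mul_assoc[symmetric])
  have square: "(mat 1 - L ** H t) ** S_prior t ** transpose (mat 1 - L ** H t) + L ** R t ** transpose L
      = S_post t + (L - K t) ** (H t ** S_prior t ** transpose (H t) + R t) ** transpose (L - K t)"
    if "1 \<le> t" "sym_pos_semidef (S_prior t)" for t L
    unfolding fuse_cov[OF that(1)]
    using that(2) R[OF that(1)] K[OF that(1)]
    by (intro fusion_covariance_complete_square) (auto simp: sym_pos_semidef_def)
  have prior: "sym_pos_semidef (S_prior (Suc t))" if "sym_pos_semidef (S_post t)" for t
    using sym_pos_semidef_add[OF sym_pos_semidef_congruence[OF that] Q] predict_cov[of "Suc t"]
    by simp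
  have post: "sym_pos_semidef (S_post t)" for t
  proof (induction t)
    case 0
    show ?case by (rule cov0)
  next
    case (Suc t)
    note S = prior[OF Suc]
    \<comment> \<open>The Joseph form of the update: at \<open>L = K\<close> the square vanishes,
      leaving a sum of two congruences.\<close>
    have "S_post (Suc t) = (mat 1 - K (Suc t) ** H (Suc t)) ** S_prior (Suc t)
        ** transpose (mat 1 - K (Suc t) ** H (Suc t)) + K (Suc t) ** R (Suc t) ** transpose (K (Suc t))"
      using square[OF _ S, of "K (Suc t)"] by simp
    then show ?case
      by (simp only:) (intro sym_pos_semidef_add sym_pos_semidef_congruence S R, simp)
  qed
  have "fusion_mse (S_prior t) (H t) (R t) (K t) \<le> fusion_mse (S_prior t) (H t) (R t) L"
    if t: "1 \<le> t" for t L
  proof -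
    have S: "sym_pos_semidef (S_prior t)"
      using prior[OF post, of "t - 1"] t by simp
    have "0 \<le> trace ((L - K t) ** (H t ** S_prior t ** transpose (H t) + R t) ** transpose (L - K t))"
      by (intro sym_pos_semidef_trace_nonneg sym_pos_semidef_congruence sym_pos_semidef_add S R t)
    then show ?thesis
      \<comment> \<open>Both errors become \<open>trace (S_post t)\<close> plus the trace of a
        square; the square is zero for the gain \<open>K t\<close>.\<close>
      unfolding fusion_mse_def square[OF t S] by (simp add: trace_add)
  qed
  with mean show ?thesis by blast
qed

end
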